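(* Let $U=[U_{i,j}]_{i,j\ge 0}$ be an irreducible almost upper-triangular transition matrix on $\mathbb N$. Then $U$ admits a positive invariant measure $(\pi_a,a\ge 0)$, which is unique up to a positive multiplicative constant, and it is given (up to the constant factor $\pi_0>0$) by $$\pi_a=\pi_0\,\frac{\det(\mathrm{Id}-U_{[0,a-1]})}{\prod_{j=1}^{a}U_{j,j-1}},\qquad a\ge 1 .$$ Moreover, $U$ is positive recurrent if and only if $$\sum_{a=1}^{\infty}\frac{\det(\mathrm{Id}-U_{[0,a-1]})}{\prod_{j=1}^{a}U_{j,j-1}}<\infty .$$
   Context: $\mathbb N=\{0,1,2,\dots\}$. A transition matrix on $\mathbb N$ is a matrix with non-negative entries whose rows sum to $1$. It is almost upper-triangular if $U_{i,j}>0\Rightarrow j\ge i-1$. For integers $a\le b$, $[a,b]=\{a,\dots,b\}$, and for $F\subset\mathbb N$, $U_F=[U_{i,j}]_{i,j\in F}$; $\mathrm{Id}$ is the identity matrix of the appropriate size. Invariant measures are taken among non-negative measures on $\mathbb N$ which are not identically zero (total mass in $(0,+\infty]$); $\pi$ is invariant by $U$ if $\sum_{a}\pi_aU_{a,b}=\pi_b$ for all $b\in\mathbb N$. Irreducible, recurrent, positive recurrent qualify the transition matrix via the corresponding Markov chain. *)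

theory Defs
  imports "HOL-Probability.Probability" "Jordan_Normal_Form.Determinant"
begin

definition transition_matrix :: "(nat \<Rightarrow> nat \<Rightarrow> real) \<Rightarrow> bool" where
  "transition_matrix U \<longleftrightarrow> (\<forall>i j. 0 \<le> U i j) \<and> (\<forall>i. U i sums 1)"

definition almost_upper_triangular :: "(nat \<Rightarrow> nat \<Rightarrow> real) \<Rightarrow> bool" where
  "almost_upper_triangular U \<longleftrightarrow> (\<forall>i j. U i j > 0 \<longrightarrow> i \<le> j + 1)"

text \<open>The invariance equation is an equation between finite numbers: \<open>sums\<close> asserts both that
  the series converges and that it has the stated value. The total mass of the measure may be
  infinite.\<close>

definition invariant_measure :: "(nat \<Rightarrow> nat \<Rightarrow> real) \<Rightarrow> (nat \<Rightarrow> real) \<Rightarrow> bool" where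
  "invariant_measure U \<pi> \<longleftrightarrow>
     (\<forall>a. 0 \<le> \<pi> a) \<and> (\<exists>a. \<pi> a \<noteq> 0) \<and> (\<forall>b. (\<lambda>a. \<pi> a * U a b) sums \<pi> b)"

text \<open>The block \<open>U\<^bsub>[0,a-1]\<^esub>\<close>, an \<open>a \<times> a\<close> matrix.\<close>

definition corner :: "(nat \<Rightarrow> nat \<Rightarrow> real) \<Rightarrow> nat \<Rightarrow> real mat" where
  "corner U a = mat a a (\<lambda>(i, j). U i j)"

text \<open>The law on trajectories \<open>\<nat> \<Rightarrow> \<nat>\<close> of the Markov chain with transition matrix \<open>U\<close> started
  at \<open>x\<close>, obtained from the Ionescu--Tulcea theorem. \<open>step_kernel U x n \<omega>\<close> is the conditional law
  of the state at time \<open>n\<close> given the states \<open>\<omega> 0, \<dots>, \<omega> (n - 1)\<close>. The lemma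
  \<open>emeasure_chain_law\<close> below gives the finite-dimensional distributions.\<close>

definition step_kernel ::
    "(nat \<Rightarrow> nat \<Rightarrow> real) \<Rightarrow> nat \<Rightarrow> nat \<Rightarrow> (nat \<Rightarrow> nat) \<Rightarrow> nat measure" where
  "step_kernel U x n \<omega> =
     (if n = 0 then return (count_space UNIV) x
      else density (count_space UNIV) (\<lambda>j. ennreal (U (\<omega> (n - 1)) j)))"

definition chain_law :: "(nat \<Rightarrow> nat \<Rightarrow> real) \<Rightarrow> nat \<Rightarrow> (nat \<Rightarrow> nat) measure" where
  "chain_law U x = projective_family.lim UNIV
     (Ionescu_Tulcea.CI (step_kernel U x) (\<lambda>_. count_space UNIV)) (\<lambda>_. count_space UNIV)"

definition irreducible_chain :: "(nat \<Rightarrow> nat \<Rightarrow> real) \<Rightarrow> bool" where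
  "irreducible_chain U \<longleftrightarrow> (\<forall>i j. \<exists>n. measure (chain_law U i) {\<omega>. \<omega> n = j} > 0)"

text \<open>The first return time is \<open>\<infinity>\<close> on trajectories that never return (\<open>Inf {} = top\<close>), so a finite
  expectation includes recurrence.\<close>

definition return_time :: "nat \<Rightarrow> (nat \<Rightarrow> nat) \<Rightarrow> ennreal" where
  "return_time i \<omega> = (INF n\<in>{n. n \<ge> 1 \<and> \<omega> n = i}. of_nat n)"

definition positive_recurrent :: "(nat \<Rightarrow> nat \<Rightarrow> real) \<Rightarrow> bool" where
  "positive_recurrent U \<longleftrightarrow> (\<forall>i. (\<integral>\<^sup>+ \<omega>. return_time i \<omega> \<partial>chain_law U i) < \<infinity>)"

lemma Ionescu_Tulcea_step_kernel:
  assumes "transition_matrix U"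
  shows "Ionescu_Tulcea (step_kernel U x) (\<lambda>_. count_space UNIV)"
proof (rule Ionescu_Tulcea.intro)
  have row: "prob_space (density (count_space (UNIV :: nat set)) (\<lambda>j. ennreal (U i j)))" for i
  proof
    have "(\<Sum>j. ennreal (U i j)) = ennreal 1"
      using assms unfolding transition_matrix_def
      by (intro sums_unique[symmetric]) (simp add: sums_ennreal del: ennreal_1)
    then show "emeasure (density (count_space (UNIV :: nat set)) (\<lambda>j. ennreal (U i j)))
        (space (density (count_space UNIV) (\<lambda>j. ennreal (U i j)))) = 1"
      by (simp add: emeasure_density nn_integral_count_space_nat)
  qed
  show "prob_space (step_kernel U x n \<omega>)" for n \<omega>
    using row by (auto simp: step_kernel_def intro!: prob_space_return)
  have row_meas: "(\<lambda>i. density (count_space UNIV) (\<lambda>j. ennreal (U i j)))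
      \<in> measurable (count_space UNIV) (subprob_algebra (count_space (UNIV :: nat set)))"
    using row by (auto simp: space_subprob_algebra intro!: prob_space_imp_subprob_space)
  show "step_kernel U x n \<in>
      measurable (PiM {0..<n} (\<lambda>_. count_space UNIV)) (subprob_algebra (count_space UNIV))" for n
  proof (cases "n = 0")
    case True
    have "return (count_space UNIV) x \<in> space (subprob_algebra (count_space UNIV))"
      by (auto simp: space_subprob_algebra intro!: prob_space_imp_subprob_space prob_space_return)
    with True show ?thesis
      by (simp add: step_kernel_def[abs_def])
  next
    case False
    then have "(\<lambda>\<omega>. \<omega> (n - 1)) \<in>
        measurable (PiM {0..<n} (\<lambda>_. count_space UNIV)) (count_space (UNIV :: nat set))"
      by (intro measurable_component_singleton) auto
    from measurable_compose[OF this row_meas] False show ?thesis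
      by (simp add: step_kernel_def[abs_def])
  qed
qed

lemma sets_chain_law:
  assumes "transition_matrix U"
  shows "sets (chain_law U x) = sets (PiM UNIV (\<lambda>_. count_space UNIV))"
proof -
  interpret Ionescu_Tulcea "step_kernel U x" "\<lambda>_. count_space UNIV"
    by (rule Ionescu_Tulcea_step_kernel[OF assms])
  show ?thesis by (simp add: chain_law_def)
qed

lemma prob_space_chain_law:
  assumes "transition_matrix U"
  shows "prob_space (chain_law U x)"
proof -
  interpret Ionescu_Tulcea "step_kernel U x" "\<lambda>_. count_space UNIV"
    by (rule Ionescu_Tulcea_step_kernel[OF assms])
  show ?thesis
  proof
    have "emeasure PF.lim (PF.emb UNIV {} {\<lambda>x. undefined}) = emeasure (CI {}) {\<lambda>x. undefined}"
      by (rule lim) (auto simp: PiM_empty)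
    also have "\<dots> = 1"
      using prob_space.emeasure_space_1[OF PF.prob_space_P[of "{}"]]
      by (simp add: CI_def space_PiM)
    also have "PF.emb UNIV {} {\<lambda>x. undefined} = space (PiM UNIV (\<lambda>_. count_space UNIV))"
      by (auto simp: prod_emb_def space_PiM)
    finally show "emeasure (chain_law U x) (space (chain_law U x)) = 1"
      by (simp add: chain_law_def)
  qed
qed

lemma emeasure_chain_law:
  assumes "transition_matrix U"
  shows "emeasure (chain_law U x) {\<omega>. \<forall>k\<le>n. \<omega> k = p k} =
    (if p 0 = x then \<Prod>k<n. ennreal (U (p k) (p (Suc k))) else 0)"
proof -
  interpret Ionescu_Tulcea "step_kernel U x" "\<lambda>_. count_space UNIV"
    by (rule Ionescu_Tulcea_step_kernel[OF assms])
  let ?M = "\<lambda>n. PiM {0..<n} (\<lambda>_. count_space (UNIV :: nat set))"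
  let ?r = "\<lambda>n. restrict p {0..<n}"
  have r_sets [measurable]: "{?r n} \<in> sets (?M n)" for n
  proof -
    have "{?r n} = (\<Pi>\<^sub>E k\<in>{0..<n}. {p k})"
      by (auto simp: PiE_iff extensional_def restrict_def fun_eq_iff)
    also have "\<dots> \<in> sets (?M n)" by (intro sets_PiM_I_finite) auto
    finally show ?thesis .
  qed
  have step: "emeasure (C 0 (Suc n) (\<lambda>_. undefined)) {?r (Suc n)} =
      emeasure (C 0 n (\<lambda>_. undefined)) {?r n} * emeasure (step_kernel U x n (?r n)) {p n}" for n
  proof -
    have u: "(\<lambda>_. undefined) \<in> space (?M 0)" by (simp add: space_PiM PiE_iff extensional_def)
    have "emeasure (C 0 (Suc n) (\<lambda>_. undefined)) {?r (Suc n)} =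
        (\<integral>\<^sup>+ \<omega>. emeasure (eP n \<omega>) {?r (Suc n)} \<partial>C 0 n (\<lambda>_. undefined))"
      using space_C[OF u, of n] sets_C[OF u, of n]
      by (simp, subst emeasure_bind[where N = "?M (Suc n)"])
         (auto simp: space_PiM measurable_cong_sets[OF sets_C[OF u] refl] PiE_eq_empty_iff)
    also have "\<dots> = (\<integral>\<^sup>+ \<omega>. emeasure (step_kernel U x n (?r n)) {p n} * indicator {?r n} \<omega>
        \<partial>C 0 n (\<lambda>_. undefined))"
    proof (intro nn_integral_cong)
      fix \<omega> assume "\<omega> \<in> space (C 0 n (\<lambda>_. undefined))"
      then have \<omega>: "\<omega> \<in> space (?M n)" using space_C[OF u, of n] by simp
      then have ext: "\<omega> \<in> extensional {0..<n}" by (simp add: space_PiM PiE_iff)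
      have upd: "fun_upd \<omega> n v = ?r (Suc n) \<longleftrightarrow> \<omega> = ?r n \<and> v = p n" for v
      proof
        assume eq: "fun_upd \<omega> n v = ?r (Suc n)"
        have "\<omega> k = ?r n k" for k
        proof (cases "k < n")
          case True then show ?thesis using fun_cong[OF eq, of k] by simp
        next
          case False then show ?thesis using ext by (simp add: extensional_def)
        qed
        moreover have "v = p n" using fun_cong[OF eq, of n] by simp
        ultimately show "\<omega> = ?r n \<and> v = p n" by blast
      next
        assume "\<omega> = ?r n \<and> v = p n"
        then show "fun_upd \<omega> n v = ?r (Suc n)" by (auto simp: fun_eq_iff restrict_def)
      qed
      have "(\<lambda>v. fun_upd \<omega> n v) -` {?r (Suc n)} \<inter> space (count_space UNIV) =
          (if \<omega> = ?r n then {p n} else {})"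
        using upd by auto
      then have "emeasure (eP n \<omega>) {?r (Suc n)} =
          emeasure (step_kernel U x n \<omega>) (if \<omega> = ?r n then {p n} else {})"
        using emeasure_eP[OF \<omega> r_sets] by simp
      then show "emeasure (eP n \<omega>) {?r (Suc n)} =
          emeasure (step_kernel U x n (?r n)) {p n} * indicator {?r n} \<omega>"
        by (auto split: split_indicator)
    qed
    also have "\<dots> = emeasure (step_kernel U x n (?r n)) {p n} *
        emeasure (C 0 n (\<lambda>_. undefined)) {?r n}"
      using sets_C[OF u, of n] by (intro nn_integral_cmult_indicator) simp
    finally show ?thesis by (simp add: mult.commute)
  qed
  have C: "emeasure (C 0 (Suc n) (\<lambda>_. undefined)) {?r (Suc n)} =
      (if p 0 = x then \<Prod>k<n. ennreal (U (p k) (p (Suc k))) else 0)" for n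
  proof (induction n)
    case 0
    have "?r 0 = (\<lambda>_. undefined)" by (auto simp: restrict_def)
    moreover have "emeasure (C 0 0 (\<lambda>_. undefined)) {\<lambda>_. undefined} = 1"
      using r_sets[of 0] by (simp add: PiM_empty)
    moreover have "emeasure (step_kernel U x 0 (?r 0)) {p 0} = (if p 0 = x then 1 else 0)"
      by (auto simp: step_kernel_def)
    ultimately show ?case
      unfolding step[of 0] by simp
  next
    case (Suc n)
    have "emeasure (step_kernel U x (Suc n) (?r (Suc n))) {p (Suc n)} =
        ennreal (U (p n) (p (Suc n)))"
      by (simp add: step_kernel_def emeasure_density nn_integral_count_space_indicator[symmetric]
          nn_integral_count_space_finite)
    then show ?case unfolding step[of "Suc n"] Suc.IH by simp
  qed
  have "{\<omega>. \<forall>k\<le>n. \<omega> k = p k} = PF.emb UNIV {0..<Suc n} {?r (Suc n)}"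
    by (auto simp: prod_emb_def space_PiM fun_eq_iff restrict_def)
       (metis less_Suc_eq_le)+
  then have "emeasure (chain_law U x) {\<omega>. \<forall>k\<le>n. \<omega> k = p k} = emeasure (CI {0..<Suc n}) {?r (Suc n)}"
    by (simp add: chain_law_def lim r_sets)
  also have "\<dots> = emeasure (C 0 (Suc n) (\<lambda>_. undefined)) {?r (Suc n)}"
  proof -
    have "PF.emb {0..<Suc n} {0..<Suc n} {?r (Suc n)} = {?r (Suc n)}"
      using sets.sets_into_space[OF r_sets[of "Suc n"]] by (intro prod_emb_id) (simp add: space_PiM)
    then show ?thesis
      using emeasure_CI[of "{0..<Suc n}" "Suc n", OF subset_refl r_sets] by simp
  qed
  finally show ?thesis unfolding C .
qed

end

theory Submission
  imports Defs
begin

text \<open>Since \<open>U\<close> lowers the state by at most one, the invariance equation in column \<open>b\<close> involves only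
  \<open>\<pi> 0, \<dots>, \<pi> (Suc b)\<close>, and irreducibility makes the coefficient \<open>U (Suc b) b\<close> of the last one
  positive. The equations are therefore a recursion that has exactly one solution for each value
  of \<open>\<pi> 0\<close>. This gives uniqueness. For existence the solution must be positive; the chain may be
  transient, so that expected visits before a return do not provide this. It follows from balancing
  the flow across the cut between \<open>m\<close> and \<open>Suc m\<close>: the flow down is \<open>\<pi> (Suc m) * U (Suc m) m\<close>, and it equals the
  flow up, a combination of \<open>\<pi> 0, \<dots>, \<pi> m\<close> with nonnegative coefficients, not all zero
  (\<open>flow_balance_across_cut\<close>, \<open>invariance_solution_positive\<close>).

  The determinant formula is Cramer's rule for this recursion. A solution \<open>v\<close>, cut off at \<open>n\<close>, is a
  row vector for which \<open>v (Id - U)\<close> has a nonzero entry only in the last column; putting it in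
  place of the first row leaves a triangular cofactor (\<open>det_one_minus_corner\<close>).

  For positive recurrence, let \<open>G y\<close> be the expected number of visits to \<open>y\<close> before the return to \<open>i\<close>
  of the chain started at \<open>i\<close>. The mean return time is the total mass of \<open>G\<close>
  (\<open>mean_return_time\<close>). If this is finite, then \<open>G\<close> is a finite invariant measure
  (\<open>excursion_occupation_invariant\<close>), so by uniqueness the invariant measures have finite mass.
  Conversely \<open>G y \<le> \<pi> y / \<pi> i\<close> for every invariant \<open>\<pi>\<close>
  (\<open>excursion_occupation_le_invariant\<close>), so finite mass of \<open>\<pi>\<close> makes the mean return time finite.
  Both use only the forward recursion for the probabilities of being at \<open>y\<close> at time \<open>n\<close> without
  having returned.\<close>

section \<open>One step of the chain under its trajectory law\<close>

lemma space_chain_law: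
  assumes "transition_matrix U"
  shows "space (chain_law U x) = UNIV"
  using sets_eq_imp_space_eq[OF sets_chain_law[OF assms]] by (simp add: space_PiM)

lemma measurable_coordinate:
  assumes "transition_matrix U"
  shows "(\<lambda>\<omega>. \<omega> k) \<in> measurable (chain_law U x) (count_space UNIV)"
  by (subst measurable_cong_sets[OF sets_chain_law[OF assms] refl]) simp

lemma sets_history:
  assumes "transition_matrix U"
  shows "{\<omega>. map \<omega> [0..<n] = ps} \<in> sets (chain_law U x)"
proof -
  have [measurable]: "(\<lambda>\<omega>. \<omega> k) \<in> measurable (chain_law U x) (count_space UNIV)" for k
    by (rule measurable_coordinate[OF assms])
  have "{\<omega>. map \<omega> [0..<n] = ps} =
      {\<omega>\<in>space (chain_law U x). length ps = n \<and> (\<forall>k<n. \<omega> k = ps ! k)}"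
    by (auto simp: space_chain_law[OF assms] list_eq_iff_nth_eq)
  also have "\<dots> \<in> sets (chain_law U x)" by measurable
  finally show ?thesis .
qed

lemma sets_history_event:
  assumes "transition_matrix U"
  shows "{\<omega>. map \<omega> [0..<n] \<in> S} \<in> sets (chain_law U x)"
proof -
  have "{\<omega>. map \<omega> [0..<n] \<in> S} = (\<Union>ps\<in>S. {\<omega>. map \<omega> [0..<n] = ps})" by auto
  also have "\<dots> \<in> sets (chain_law U x)"
    by (rule sets.countable_UN') (auto simp: sets_history[OF assms])
  finally show ?thesis .
qed

text \<open>There are only countably many histories up to time \<open>n\<close>, so countable additivity reduces the
  Markov property to a single history, where it is the product formula for cylinders.\<close>

lemma markov_step:
  assumes tm: "transition_matrix U"
  shows "emeasure (chain_law U x)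
      {\<omega>. map \<omega> [0..<Suc n] \<in> S \<and> \<omega> n = a \<and> \<omega> (Suc n) = b} =
    emeasure (chain_law U x) {\<omega>. map \<omega> [0..<Suc n] \<in> S \<and> \<omega> n = a} * ennreal (U a b)"
proof -
  let ?M = "chain_law U x"
  define L where "L = {ps\<in>S. length ps = Suc n \<and> ps ! n = a}"
  let ?A = "\<lambda>ps. {\<omega>. map \<omega> [0..<Suc n] = ps}"
  let ?B = "\<lambda>ps. {\<omega>. map \<omega> [0..<Suc (Suc n)] = ps @ [b]}"
  have sets: "?A ps \<in> sets ?M" "?B ps \<in> sets ?M" for ps
    by (rule sets_history[OF tm])+
  have one: "emeasure ?M (?B ps) = emeasure ?M (?A ps) * ennreal (U a b)" if "ps \<in> L" for ps
  proof -
    have len: "length ps = Suc n" and last: "ps ! n = a" using that by (auto simp: L_def)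
    have A: "?A ps = {\<omega>. \<forall>k\<le>n. \<omega> k = (ps @ [b]) ! k}"
      by (auto simp: list_eq_iff_nth_eq len nth_append less_Suc_eq_le simp del: upt_Suc)
    have B: "?B ps = {\<omega>. \<forall>k\<le>Suc n. \<omega> k = (ps @ [b]) ! k}"
      by (auto simp: list_eq_iff_nth_eq len less_Suc_eq_le simp del: upt_Suc)
    show ?thesis
      unfolding A B emeasure_chain_law[OF tm] using len last by (simp add: nth_append)
  qed
  have UA: "{\<omega>. map \<omega> [0..<Suc n] \<in> S \<and> \<omega> n = a} = (\<Union>ps\<in>L. ?A ps)"
    by (auto simp: L_def nth_append)
  have UB: "{\<omega>. map \<omega> [0..<Suc n] \<in> S \<and> \<omega> n = a \<and> \<omega> (Suc n) = b} = (\<Union>ps\<in>L. ?B ps)"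
    by (auto simp: L_def nth_append)
  have "emeasure ?M (\<Union>ps\<in>L. ?B ps) = (\<integral>\<^sup>+ps. emeasure ?M (?B ps) \<partial>count_space L)"
    by (rule emeasure_UN_countable) (auto simp: sets disjoint_family_on_def simp del: upt_Suc)
  also have "\<dots> = (\<integral>\<^sup>+ps. emeasure ?M (?A ps) * ennreal (U a b) \<partial>count_space L)"
    by (rule nn_integral_cong) (simp add: one del: upt_Suc)
  also have "\<dots> = (\<integral>\<^sup>+ps. emeasure ?M (?A ps) \<partial>count_space L) * ennreal (U a b)"
    by (rule nn_integral_multc) simp
  also have "(\<integral>\<^sup>+ps. emeasure ?M (?A ps) \<partial>count_space L) = emeasure ?M (\<Union>ps\<in>L. ?A ps)"
    by (rule emeasure_UN_countable[symmetric])
       (auto simp: sets disjoint_family_on_def simp del: upt_Suc)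
  finally show ?thesis unfolding UA UB .
qed

lemma forward_equation:
  assumes tm: "transition_matrix U"
  shows "emeasure (chain_law U x) {\<omega>. map \<omega> [0..<Suc n] \<in> S \<and> \<omega> (Suc n) = b} =
    (\<Sum>a. emeasure (chain_law U x) {\<omega>. map \<omega> [0..<Suc n] \<in> S \<and> \<omega> n = a} * ennreal (U a b))"
proof -
  let ?A = "\<lambda>a. {\<omega>. map \<omega> [0..<Suc n] \<in> S \<and> \<omega> n = a \<and> \<omega> (Suc n) = b}"
  have "?A a = {\<omega>. map \<omega> [0..<Suc (Suc n)] \<in>
      {ps. length ps = Suc (Suc n) \<and> butlast ps \<in> S \<and> ps ! n = a \<and> ps ! Suc n = b}}" for a
    by (auto simp: nth_append butlast_append)
  then have "?A a \<in> sets (chain_law U x)" for a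
    by (simp only: sets_history_event[OF tm])
  then have "range ?A \<subseteq> sets (chain_law U x)" by blast
  then have "(\<Sum>a. emeasure (chain_law U x) (?A a)) = emeasure (chain_law U x) (\<Union>a. ?A a)"
    by (rule suminf_emeasure) (auto simp: disjoint_family_on_def)
  also have "(\<Union>a. ?A a) = {\<omega>. map \<omega> [0..<Suc n] \<in> S \<and> \<omega> (Suc n) = b}" by auto
  finally show ?thesis unfolding markov_step[OF tm] by simp
qed

text \<open>A set that no positive entry of \<open>U\<close> leaves is never left almost surely, so under
  irreducibility every cut of the state space is crossed by a positive entry.\<close>

lemma irreducible_crosses_cut:
  assumes tm: "transition_matrix U" and irr: "irreducible_chain U"
    and i: "i \<in> C" and j: "j \<notin> C"
  shows "\<exists>a\<in>C. \<exists>b. b \<notin> C \<and> U a b > 0"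
proof (rule ccontr)
  assume "\<not> ?thesis"
  then have "\<not> 0 < U a b" if "a \<in> C" "b \<notin> C" for a b using that by blast
  moreover have "0 \<le> U a b" for a b using tm by (simp add: transition_matrix_def)
  ultimately have closed: "U a b = 0" if "a \<in> C" "b \<notin> C" for a b
    using that by (intro antisym) (auto simp: not_less)
  have "emeasure (chain_law U i) {\<omega>. \<omega> n = b} = 0" if "b \<notin> C" for n b
    using that
  proof (induction n arbitrary: b)
    case 0
    then have "i \<noteq> b" using i by auto
    then show ?case using emeasure_chain_law[OF tm, of i 0 "\<lambda>_. b"] by simp
  next
    case (Suc n)
    have "emeasure (chain_law U i) {\<omega>. \<omega> n = a} * ennreal (U a b) = 0" for a
      using Suc.IH[of a] closed[of a b] Suc.prems by (cases "a \<in> C") auto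
    then have "(\<Sum>a. emeasure (chain_law U i) {\<omega>. \<omega> n = a} * ennreal (U a b)) = 0"
      by (simp only: suminf_zero)
    then show ?case using forward_equation[OF tm, of i n UNIV b] by simp
  qed
  from this[OF j] have "measure (chain_law U i) {\<omega>. \<omega> n = j} = 0" for n
    by (simp add: measure_def)
  then show False using irr by (metis irreducible_chain_def less_irrefl)
qed

section \<open>The invariance equations\<close>

lemma below_subdiagonal_zero:
  assumes "transition_matrix U" "almost_upper_triangular U" "Suc j < i"
  shows "U i j = 0"
  using assms unfolding transition_matrix_def almost_upper_triangular_def
  by (metis Suc_eq_plus1 less_eq_real_def not_less)

text \<open>Irreducibility requires some step from \<open>{Suc n..}\<close> to below it, and only the step from \<open>Suc n\<close>
  to \<open>n\<close> is short enough.\<close>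

lemma subdiagonal_positive:
  assumes tm: "transition_matrix U" and irr: "irreducible_chain U"
    and hess: "almost_upper_triangular U"
  shows "U (Suc n) n > 0"
proof -
  have "\<exists>a\<in>{Suc n..}. \<exists>b. b \<notin> {Suc n..} \<and> U a b > 0"
    by (rule irreducible_crosses_cut[OF tm irr, of "Suc n" _ n]) auto
  then obtain a b where ab: "Suc n \<le> a" "\<not> Suc n \<le> b" "U a b > 0" by auto
  moreover have "a \<le> b + 1" using hess ab(3) by (simp add: almost_upper_triangular_def)
  ultimately have "a = Suc n" "b = n" by auto
  with ab(3) show ?thesis by simp
qed

lemma invariance_finite_sum:
  assumes tm: "transition_matrix U" and hess: "almost_upper_triangular U"
  shows "(\<lambda>a. v a * U a b) sums v b \<longleftrightarrow> (\<Sum>a\<le>Suc b. v a * U a b) = v b"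
proof -
  have "(\<lambda>a. v a * U a b) sums (\<Sum>a\<le>Suc b. v a * U a b)"
    by (rule sums_finite) (auto simp: below_subdiagonal_zero[OF tm hess])
  then show ?thesis using sums_unique2 by metis
qed

text \<open>Summing the invariance equations over \<open>{..m}\<close>, the flow between states of \<open>{..m}\<close> cancels and
  leaves the flow down across the cut, which passes through \<open>U (Suc m) m\<close> alone, and the flow up,
  in which \<open>1 - (\<Sum>b\<le>m. U a b)\<close> is the probability of jumping from \<open>a\<close> to above \<open>m\<close>.\<close>

lemma flow_balance_across_cut:
  assumes tm: "transition_matrix U" and hess: "almost_upper_triangular U"
    and inv: "\<And>b. (\<Sum>a\<le>Suc b. v a * U a b) = v b"
  shows "v (Suc m) * U (Suc m) m = (\<Sum>a\<le>m. v a * (1 - (\<Sum>b\<le>m. U a b)))"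
proof -
  have "(\<Sum>b\<le>m. v b) = (\<Sum>b\<le>m. \<Sum>a\<le>Suc b. v a * U a b)" using inv by simp
  also have "\<dots> = (\<Sum>b\<le>m. \<Sum>a\<le>Suc m. v a * U a b)"
    by (intro sum.cong refl sum.mono_neutral_left)
       (auto simp: below_subdiagonal_zero[OF tm hess])
  also have "\<dots> = (\<Sum>a\<le>Suc m. \<Sum>b\<le>m. v a * U a b)" by (rule sum.swap)
  also have "\<dots> = (\<Sum>a\<le>m. v a * (\<Sum>b\<le>m. U a b)) + v (Suc m) * (\<Sum>b\<le>m. U (Suc m) b)"
    by (simp add: sum_distrib_left)
  also have "(\<Sum>b\<le>m. U (Suc m) b) = (\<Sum>b\<in>{m}. U (Suc m) b)"
    by (rule sum.mono_neutral_right) (auto simp: below_subdiagonal_zero[OF tm hess])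
  finally show ?thesis by (simp add: algebra_simps sum_subtractf)
qed

text \<open>Positivity propagates upward: the cut above \<open>m\<close> is crossed by some positive entry, so the
  upward flow out of the already positive masses is positive, and it equals the downward flow
  out of \<open>Suc m\<close>.\<close>

lemma invariance_solution_positive:
  assumes tm: "transition_matrix U" and irr: "irreducible_chain U"
    and hess: "almost_upper_triangular U"
    and inv: "\<And>b. (\<Sum>a\<le>Suc b. v a * U a b) = v b"
    and v0: "v 0 > 0"
  shows "v n > 0"
proof (induction n rule: less_induct)
  case (less n)
  show ?case
  proof (cases n)
    case 0
    with v0 show ?thesis by simp
  next
    case (Suc m)
    have pos: "v a > 0" if "a \<le> m" for a using less[of a] that Suc by simp
    have nonneg: "0 \<le> U a b" and row: "U a sums 1" for a b
      using tm by (auto simp: transition_matrix_def)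
    have part: "sum (U a) B \<le> 1" if "finite B" for a B
      using sum_le_suminf[of "U a" B] row[of a] nonneg that
      by (auto simp: sums_iff)
    have "\<exists>a\<in>{..m}. \<exists>b. b \<notin> {..m} \<and> U a b > 0"
      by (rule irreducible_crosses_cut[OF tm irr, of 0 _ "Suc m"]) auto
    then obtain a b where ab: "a \<le> m" "\<not> b \<le> m" "U a b > 0" by auto
    have "(\<Sum>b\<le>m. U a b) < 1"
      using part[of "insert b {..m}" a] ab by simp
    then have "0 < (\<Sum>a\<le>m. v a * (1 - (\<Sum>b\<le>m. U a b)))"
      using ab pos part by (intro sum_pos2[of _ a]) (auto simp: less_imp_le)
    then have "0 < v (Suc m) * U (Suc m) m"
      by (simp add: flow_balance_across_cut[OF tm hess inv])
    then show ?thesis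
      using subdiagonal_positive[OF tm irr hess, of m] Suc by (simp add: zero_less_mult_iff)
  qed
qed

text \<open>The invariance equation in column \<open>b\<close>, solved for the value at \<open>Suc b\<close>.\<close>

fun balance_solution :: "(nat \<Rightarrow> nat \<Rightarrow> real) \<Rightarrow> nat \<Rightarrow> real" where
  "balance_solution U 0 = 1"
| "balance_solution U (Suc b) =
    (balance_solution U b - (\<Sum>a\<le>b. balance_solution U a * U a b)) / U (Suc b) b"

lemma balance_solution_solves:
  assumes "U (Suc b) b \<noteq> 0"
  shows "(\<Sum>a\<le>Suc b. balance_solution U a * U a b) = balance_solution U b"
  using assms by simp

section \<open>The determinant formula\<close>

text \<open>Replacing row \<open>0\<close> of \<open>Id - U\<close> by the combination of its rows with coefficients \<open>v\<close> multiplies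
  the determinant by \<open>v 0\<close>. By the invariance equations the new row vanishes except for its last
  entry \<open>v n * U n (n - 1)\<close>, and the cofactor of that entry is a triangular determinant with the
  entries \<open>- U j (j - 1)\<close> on the diagonal.\<close>

lemma det_one_minus_corner:
  assumes zero: "\<And>i j. Suc j < i \<Longrightarrow> U i j = 0"
    and inv: "\<And>b. (\<Sum>a\<le>Suc b. v a * U a b) = v b"
    and n: "n \<ge> 1"
  shows "v 0 * Determinant.det (1\<^sub>m n - corner U n) = v n * (\<Prod>j=1..n. U j (j - 1))"
proof -
  obtain m where nm: "n = Suc m" using n by (cases n) auto
  define M where "M = 1\<^sub>m n - corner U n"
  \<comment> \<open>left multiplication by \<open>E\<close> replaces row \<open>0\<close> by the combination with coefficients \<open>v\<close>\<close>
  define E where "E = mat n n (\<lambda>(i, j). if i = 0 then v j else if i = j then 1 else 0)"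
  have M: "M \<in> carrier_mat n n" by (simp add: M_def corner_def minus_carrier_mat)
  have E: "E \<in> carrier_mat n n" by (simp add: E_def)
  have EM: "E * M \<in> carrier_mat n n" using E M by simp
  have Eij: "E $$ (i, j) = (if i = 0 then v j else if i = j then 1 else 0)"
    if "i < n" "j < n" for i j
    using that by (simp add: E_def)
  have Mij: "M $$ (i, j) = (if i = j then 1 else 0) - U i j" if "i < n" "j < n" for i j
    using that by (simp add: M_def corner_def)
  have EMij: "(E * M) $$ (i, j) = (\<Sum>k<n. E $$ (i, k) * M $$ (k, j))"
    if "i < n" "j < n" for i j
    using that E M by (simp add: scalar_prod_def atLeast0LessThan)
  have "upper_triangular E" by (auto simp: E_def upper_triangular_def)
  then have detE: "Determinant.det E = v 0"
  proof (subst det_upper_triangular[OF _ E])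
    have "prod_list (diag_mat E) = (\<Prod>i=0..<n. if i = 0 then v 0 else 1)"
      unfolding prod_list_diag_prod by (rule prod.cong) (auto simp: E_def)
    also have "\<dots> = v 0" using n by (subst prod.delta) auto
    finally show "prod_list (diag_mat E) = v 0" .
  qed
  have row0: "(E * M) $$ (0, b) = (if b = m then v n * U n m else 0)" if "b < n" for b
  proof -
    have "(E * M) $$ (0, b) = (\<Sum>k<n. (if k = b then v k else 0) - v k * U k b)"
      using that n by (auto simp: EMij Mij Eij algebra_simps intro!: sum.cong)
    also have "\<dots> = v b - (\<Sum>k<n. v k * U k b)"
      using that by (simp add: sum_subtractf)
    also have "\<dots> = (if b = m then v n * U n m else 0)"
    proof (cases "b = m")
      case True
      then show ?thesis using inv[of m] by (simp add: nm lessThan_Suc_atMost)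
    next
      case False
      have "(\<Sum>k<n. v k * U k b) = (\<Sum>k\<le>Suc b. v k * U k b)"
        using that False by (intro sum.mono_neutral_right) (auto simp: nm zero)
      with False inv[of b] show ?thesis by simp
    qed
    finally show ?thesis .
  qed
  have rows: "(E * M) $$ (i, j) = M $$ (i, j)" if "0 < i" "i < n" "j < n" for i j
  proof -
    have "(E * M) $$ (i, j) = (\<Sum>k<n. if k = i then M $$ (k, j) else 0)"
      unfolding EMij[OF that(2,3)] by (rule sum.cong) (use that in \<open>auto simp: Eij\<close>)
    with that show ?thesis by simp
  qed
  define D where "D = mat_delete (E * M) 0 m"
  have D: "D \<in> carrier_mat m m"
    using mat_delete_carrier[OF EM, of 0 m] by (simp add: D_def nm)
  have Dij: "D $$ (i, j) = (if Suc i = j then 1 else 0) - U (Suc i) j" if "i < m" "j < m" for i j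
  proof -
    have "D $$ (i, j) = (E * M) $$ (Suc i, j)"
      using that carrier_matD[OF EM] by (simp add: D_def mat_delete_def nm del: index_mult_mat)
    also have "\<dots> = M $$ (Suc i, j)" using that by (intro rows) (auto simp: nm)
    finally show ?thesis using that by (simp add: Mij nm)
  qed
  have "upper_triangular D"
    using D by (auto simp: upper_triangular_def Dij zero)
  then have "Determinant.det D = (\<Prod>i<m. - U (Suc i) i)"
    using D by (subst det_upper_triangular[OF _ D])
      (auto simp: prod_list_diag_prod Dij atLeast0LessThan intro!: prod.cong)
  also have "\<dots> = (-1) ^ m * (\<Prod>i<m. U (Suc i) i)"
    by (simp add: prod_uminus)
  finally have detD: "Determinant.det D = (-1) ^ m * (\<Prod>i<m. U (Suc i) i)" .
  have "v 0 * Determinant.det M = Determinant.det (E * M)"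
    by (simp add: det_mult[OF E M] detE)
  also have "\<dots> = (\<Sum>j<n. (E * M) $$ (0, j) * cofactor (E * M) 0 j)"
    using n by (intro laplace_expansion_row[OF EM]) auto
  also have "\<dots> = (\<Sum>j<n. if j = m then v n * U n m * cofactor (E * M) 0 m else 0)"
    by (intro sum.cong refl) (auto simp: row0)
  also have "\<dots> = v n * U n m * ((-1) ^ m * Determinant.det D)"
    by (simp add: nm cofactor_def D_def)
  also have "\<dots> = v n * (\<Prod>i<n. U (Suc i) i)"
    by (simp add: detD nm power_mult_distrib[symmetric] mult.assoc[symmetric]
        flip: power_add mult_2)
  also have "(\<Prod>i<n. U (Suc i) i) = (\<Prod>j=1..n. U j (j - 1))"
    by (rule prod.reindex_bij_witness[of _ "\<lambda>j. j - 1" Suc]) auto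
  finally show ?thesis by (simp add: M_def)
qed

section \<open>Excursions and the mean return time\<close>

text \<open>The probability of being at \<open>y\<close> at time \<open>n\<close> within the first excursion from \<open>i\<close>. Time \<open>0\<close> is left
  out of the taboo because the chain starts at \<open>i\<close>, so that \<open>n\<close> ranges over all times before the
  return.\<close>

definition excursion_visit :: "(nat \<Rightarrow> nat \<Rightarrow> real) \<Rightarrow> nat \<Rightarrow> nat \<Rightarrow> nat \<Rightarrow> ennreal" where
  "excursion_visit U i n y =
    emeasure (chain_law U i) {\<omega>. (\<forall>k\<in>{1..n}. \<omega> k \<noteq> i) \<and> \<omega> n = y}"

lemma excursion_visit_0:
  assumes "transition_matrix U"
  shows "excursion_visit U i 0 y = (if y = i then 1 else 0)"
  using emeasure_chain_law[OF assms, of i 0 "\<lambda>_. y"] by (simp add: excursion_visit_def)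

lemma excursion_visit_Suc:
  assumes tm: "transition_matrix U"
  shows "excursion_visit U i (Suc n) y =
    (if y = i then 0 else \<Sum>a. excursion_visit U i n a * ennreal (U a y))"
proof (cases "y = i")
  case True
  then have empty: "{\<omega>. (\<forall>k\<in>{1..Suc n}. \<omega> k \<noteq> i) \<and> \<omega> (Suc n) = y} = {}" by auto
  show ?thesis unfolding excursion_visit_def empty using True by simp
next
  case False
  let ?S = "{ps. \<forall>k\<in>{1..n}. ps ! k \<noteq> i}"
  have S: "map \<omega> [0..<Suc n] \<in> ?S \<longleftrightarrow> (\<forall>k\<in>{1..n}. \<omega> k \<noteq> i)" for \<omega>
    by (auto simp del: upt_Suc)
  have "(\<forall>k\<in>{1..Suc n}. \<omega> k \<noteq> i) \<and> \<omega> (Suc n) = y \<longleftrightarrow>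
      (\<forall>k\<in>{1..n}. \<omega> k \<noteq> i) \<and> \<omega> (Suc n) = y" for \<omega>
    using False by (auto simp: le_Suc_eq)
  with False forward_equation[OF tm, of i n ?S y] show ?thesis
    unfolding excursion_visit_def S by simp
qed

text \<open>A value in \<open>{0, 1, \<dots>, \<infinity>}\<close> is the number of naturals below it, and \<open>n\<close> is below the return time
  when no return has happened by time \<open>n\<close>.\<close>

lemma return_time_eq_suminf:
  "return_time i \<omega> = (\<Sum>n. indicator {\<omega>. \<forall>k\<in>{1..n}. \<omega> k \<noteq> i} \<omega>)"
proof (cases "\<exists>m\<ge>1. \<omega> m = i")
  case False
  then have "return_time i \<omega> = \<infinity>" by (auto simp: return_time_def)
  moreover have "(\<Sum>n::nat. 1::ennreal) = \<infinity>"
    by (simp add: nn_integral_count_space_nat[symmetric])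
  moreover have "indicator {\<omega>. \<forall>k\<in>{1..n}. \<omega> k \<noteq> i} \<omega> = (1::ennreal)" for n
    using False by auto
  ultimately show ?thesis by simp
next
  case True
  define m where "m = (LEAST m. m \<ge> 1 \<and> \<omega> m = i)"
  have m: "m \<ge> 1" "\<omega> m = i" using LeastI_ex[of "\<lambda>m. m \<ge> 1 \<and> \<omega> m = i"] True by (auto simp: m_def)
  have least: "m \<le> k" if "k \<ge> 1" "\<omega> k = i" for k
    unfolding m_def using that by (intro Least_le) auto
  have "return_time i \<omega> = of_nat m"
    unfolding return_time_def
    by (intro antisym INF_lower INF_greatest) (use m least in auto)
  moreover have "indicator {\<omega>. \<forall>k\<in>{1..n}. \<omega> k \<noteq> i} \<omega> = (if n < m then 1 else 0 :: ennreal)" for n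
    using m least[of "_"] by (fastforce simp: indicator_def not_less)
  moreover have "(\<lambda>n. if n < m then 1 else 0 :: ennreal) sums of_nat m"
    using sums_If_finite[of "\<lambda>n. n < m" "\<lambda>_. 1 :: ennreal"] by simp
  ultimately show ?thesis by (simp add: sums_unique)
qed

lemma ennreal_suminf_swap:
  fixes f :: "nat \<Rightarrow> nat \<Rightarrow> ennreal"
  shows "(\<Sum>y. \<Sum>n. f n y) = (\<Sum>n. \<Sum>y. f n y)"
proof -
  have "(\<Sum>y. \<Sum>n. f n y) = (\<integral>\<^sup>+y. (\<Sum>n. f n y) \<partial>count_space UNIV)"
    by (simp only: nn_integral_count_space_nat)
  also have "\<dots> = (\<Sum>n. \<integral>\<^sup>+y. f n y \<partial>count_space UNIV)"
    by (rule nn_integral_suminf) simp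
  finally show ?thesis by (simp only: nn_integral_count_space_nat)
qed

definition excursion_occupation :: "(nat \<Rightarrow> nat \<Rightarrow> real) \<Rightarrow> nat \<Rightarrow> nat \<Rightarrow> ennreal" where
  "excursion_occupation U i y = (\<Sum>n. excursion_visit U i n y)"

text \<open>Each time before the return is spent in exactly one state, so the length of the excursion is
  the total number of visits that it makes.\<close>

lemma mean_return_time:
  assumes tm: "transition_matrix U"
  shows "(\<integral>\<^sup>+ \<omega>. return_time i \<omega> \<partial>chain_law U i) = (\<Sum>y. excursion_occupation U i y)"
proof -
  let ?A = "\<lambda>n. {\<omega>. \<forall>k\<in>{1..n}. \<omega> k \<noteq> i}"
  let ?B = "\<lambda>n y. {\<omega>. (\<forall>k\<in>{1..n}. \<omega> k \<noteq> i) \<and> \<omega> n = y}"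
  have B: "?B n y \<in> sets (chain_law U i)" for n y
  proof -
    have "?B n y = {\<omega>. map \<omega> [0..<Suc n] \<in> {ps. (\<forall>k\<in>{1..n}. ps ! k \<noteq> i) \<and> ps ! n = y}}"
      by (auto simp del: upt_Suc)
    then show ?thesis by (simp only: sets_history_event[OF tm])
  qed
  have UB: "(\<Union>y. ?B n y) = ?A n" for n by auto
  have A: "?A n \<in> sets (chain_law U i)" for n
    unfolding UB[symmetric] by (rule sets.countable_UN) (use B in blast)
  have "(\<integral>\<^sup>+ \<omega>. return_time i \<omega> \<partial>chain_law U i) =
      (\<Sum>n. \<integral>\<^sup>+ \<omega>. indicator (?A n) \<omega> \<partial>chain_law U i)"
    unfolding return_time_eq_suminf by (rule nn_integral_suminf) (use A in auto)
  also have "\<dots> = (\<Sum>n. emeasure (chain_law U i) (?A n))"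
    using A by simp
  also have "\<dots> = (\<Sum>n. \<Sum>y. excursion_visit U i n y)"
  proof (rule suminf_cong)
    fix n
    have "(\<Sum>y. emeasure (chain_law U i) (?B n y)) = emeasure (chain_law U i) (\<Union>y. ?B n y)"
    proof (rule suminf_emeasure)
      show "range (?B n) \<subseteq> sets (chain_law U i)" using B by blast
      show "disjoint_family (?B n)" by (auto simp: disjoint_family_on_def)
    qed
    then show "emeasure (chain_law U i) (?A n) = (\<Sum>y. excursion_visit U i n y)"
      by (simp only: excursion_visit_def UB)
  qed
  also have "\<dots> = (\<Sum>y. excursion_occupation U i y)"
    unfolding excursion_occupation_def by (rule ennreal_suminf_swap[symmetric])
  finally show ?thesis .
qed

lemma excursion_occupation_self:
  assumes tm: "transition_matrix U"
  shows "excursion_occupation U i i = 1"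
proof -
  have "excursion_visit U i n i = (if n = 0 then 1 else 0)" for n
    by (cases n) (auto simp: excursion_visit_0[OF tm] excursion_visit_Suc[OF tm])
  then show ?thesis
    using sums_unique[OF sums_single[of 0 "\<lambda>_. 1 :: ennreal"]]
    by (simp add: excursion_occupation_def)
qed

lemma excursion_occupation_step:
  assumes tm: "transition_matrix U" and "y \<noteq> i"
  shows "excursion_occupation U i y = (\<Sum>a. excursion_occupation U i a * ennreal (U a y))"
proof -
  have "excursion_occupation U i y = (\<Sum>n. excursion_visit U i (Suc n) y)"
    unfolding excursion_occupation_def
    using suminf_offset[of "\<lambda>n. excursion_visit U i n y" 1] assms
    by (simp add: excursion_visit_0)
  also have "\<dots> = (\<Sum>n. \<Sum>a. excursion_visit U i n a * ennreal (U a y))"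
    using assms by (simp add: excursion_visit_Suc)
  also have "\<dots> = (\<Sum>a. \<Sum>n. excursion_visit U i n a * ennreal (U a y))"
    by (rule ennreal_suminf_swap[symmetric])
  finally show ?thesis by (simp add: excursion_occupation_def)
qed

lemma row_suminf_ennreal:
  assumes "transition_matrix U"
  shows "(\<Sum>y. ennreal (U a y)) = 1"
proof -
  have "0 \<le> U a y" "U a sums 1" for y using assms by (auto simp: transition_matrix_def)
  from suminf_ennreal_eq[OF this] show ?thesis by simp
qed

text \<open>By the forward recursion, \<open>U\<close> fixes the occupation measure away from \<open>i\<close>. The rows of \<open>U\<close> sum to
  \<open>1\<close>, so \<open>U\<close> preserves total mass; when this is finite, the rest can be subtracted, and the masses
  at \<open>i\<close> agree as well.\<close>

lemma excursion_occupation_invariant: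
  assumes tm: "transition_matrix U"
    and fin: "(\<Sum>y. excursion_occupation U i y) < \<infinity>"
  shows "(\<Sum>a. excursion_occupation U i a * ennreal (U a y)) = excursion_occupation U i y"
proof (cases "y = i")
  case False
  then show ?thesis using excursion_occupation_step[OF tm] by simp
next
  case True
  let ?G = "excursion_occupation U i"
  define f where "f y = (\<Sum>a. ?G a * ennreal (U a y))" for y
  have f: "f y = ?G y" if "y \<noteq> i" for y
    using excursion_occupation_step[OF tm that] by (simp add: f_def)
  have split: "(\<Sum>y. g y) = g i + (\<Sum>y. if y = i then 0 else g y)" for g :: "nat \<Rightarrow> ennreal"
  proof -
    have "(\<Sum>y. g y) = (\<Sum>y. (if y = i then g y else 0) + (if y = i then 0 else g y))"
      by (intro suminf_cong) auto
    also have "\<dots> = (\<Sum>y. if y = i then g y else 0) + (\<Sum>y. if y = i then 0 else g y)"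
      by (intro suminf_add[symmetric] summableI)
    finally show ?thesis using sums_unique[OF sums_single[of i g]] by simp
  qed
  have "(\<Sum>y. f y) = (\<Sum>a. \<Sum>y. ?G a * ennreal (U a y))"
    unfolding f_def by (rule ennreal_suminf_swap)
  also have "\<dots> = (\<Sum>a. ?G a)" by (simp add: row_suminf_ennreal[OF tm])
  finally have "f i + (\<Sum>y. if y = i then 0 else f y) = ?G i + (\<Sum>y. if y = i then 0 else ?G y)"
    unfolding split[of f] split[of ?G] .
  moreover have "(\<Sum>y. if y = i then 0 else f y) = (\<Sum>y. if y = i then 0 else ?G y)"
    by (intro suminf_cong) (simp add: f)
  moreover have "(\<Sum>y. if y = i then 0 else ?G y) \<noteq> \<infinity>"
    using fin unfolding split[of ?G] by (auto simp: less_top)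
  ultimately have "f i = ?G i" by (simp add: add.commute[of _ "suminf _"])
  with True show ?thesis by (simp add: f_def)
qed

text \<open>The occupation up to a finite time, scaled by \<open>\<pi> i\<close>, is at most \<open>\<pi> i\<close> at \<open>i\<close>. Elsewhere it is obtained by
  applying \<open>U\<close> to the occupation up to one step earlier, so if that one lies below \<open>\<pi>\<close>, then it
  lies below \<open>\<pi> U = \<pi>\<close>.\<close>

lemma excursion_occupation_le_invariant:
  assumes tm: "transition_matrix U" and inv: "invariant_measure U \<pi>"
  shows "excursion_occupation U i y * ennreal (\<pi> i) \<le> ennreal (\<pi> y)"
proof -
  have \<pi>: "0 \<le> \<pi> a" and U: "0 \<le> U a b" for a b
    using inv tm by (auto simp: invariant_measure_def transition_matrix_def)
  have step: "(\<Sum>a. ennreal (\<pi> a) * ennreal (U a b)) = ennreal (\<pi> b)" for b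
    using inv \<pi> U suminf_ennreal_eq[of "\<lambda>a. \<pi> a * U a b" "\<pi> b"]
    by (simp add: invariant_measure_def ennreal_mult)
  have part: "(\<Sum>n<N. excursion_visit U i n y * ennreal (\<pi> i)) \<le> ennreal (\<pi> y)" for N y
  proof (induction N arbitrary: y)
    case (Suc N)
    show ?case
    proof (cases "y = i")
      case True
      then show ?thesis
        by (simp add: sum.lessThan_Suc_shift excursion_visit_0[OF tm] excursion_visit_Suc[OF tm]
            del: sum.lessThan_Suc)
    next
      case False
      have "(\<Sum>n<Suc N. excursion_visit U i n y * ennreal (\<pi> i)) =
          (\<Sum>n<N. (\<Sum>a. excursion_visit U i n a * ennreal (\<pi> i) * ennreal (U a y)))"
        using False
        by (simp add: sum.lessThan_Suc_shift excursion_visit_0[OF tm] excursion_visit_Suc[OF tm]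
            mult_ac del: sum.lessThan_Suc flip: ennreal_suminf_multc ennreal_suminf_cmult)
      also have "\<dots> = (\<Sum>a. (\<Sum>n<N. excursion_visit U i n a * ennreal (\<pi> i)) * ennreal (U a y))"
        by (subst suminf_sum[symmetric]) (auto simp: sum_distrib_right)
      also have "\<dots> \<le> (\<Sum>a. ennreal (\<pi> a) * ennreal (U a y))"
        by (intro suminf_le mult_right_mono Suc.IH summableI) auto
      finally show ?thesis by (simp add: step)
    qed
  qed simp
  have "(\<Sum>n. excursion_visit U i n y * ennreal (\<pi> i)) \<le> ennreal (\<pi> y)"
    by (rule suminf_le_const) (use part in auto)
  then show ?thesis by (simp add: excursion_occupation_def)
qed

section \<open>Invariant measures and positive recurrence\<close>

theorem theorem2p1:
  fixes U :: "nat \<Rightarrow> nat \<Rightarrow> real"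
  assumes "transition_matrix U"
    and "irreducible_chain U"
    and "almost_upper_triangular U"
  shows "(\<exists>\<pi>. invariant_measure U \<pi> \<and> (\<forall>a. \<pi> a > 0)) \<and>
    (\<forall>\<pi> \<mu>. invariant_measure U \<pi> \<longrightarrow> invariant_measure U \<mu> \<longrightarrow>
       (\<exists>c>0. \<forall>a. \<mu> a = c * \<pi> a)) \<and>
    (\<forall>\<pi>. invariant_measure U \<pi> \<longrightarrow> \<pi> 0 > 0 \<and>
       (\<forall>a\<ge>1. \<pi> a = \<pi> 0 * (Determinant.det (1\<^sub>m a - corner U a) / (\<Prod>j=1..a. U j (j - 1))))) \<and>
    (positive_recurrent U \<longleftrightarrow>
       summable (\<lambda>a. Determinant.det (1\<^sub>m (Suc a) - corner U (Suc a)) /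
         (\<Prod>j=1..Suc a. U j (j - 1))))"
proof -
  note tm = assms(1) and irr = assms(2) and hess = assms(3)
  note sub = subdiagonal_positive[OF tm irr hess]
  let ?q = "\<lambda>a. Determinant.det (1\<^sub>m a - corner U a) / (\<Prod>j=1..a. U j (j - 1))"
  have prod_nz: "(\<Prod>j=1..a. U j (j - 1)) \<noteq> 0" for a
  proof -
    have "U j (j - 1) \<noteq> 0" if "j \<ge> 1" for j
      using sub[of "j - 1"] that by simp
    then show ?thesis by simp
  qed
  have formula: "v a = v 0 * ?q a"
    if "\<And>b. (\<Sum>a\<le>Suc b. v a * U a b) = v b" "a \<ge> 1" for v a
    using det_one_minus_corner[of U v a] below_subdiagonal_zero[OF tm hess] that prod_nz[of a]
    by (simp add: field_simps)
  have balance: "(\<Sum>a\<le>Suc b. \<pi> a * U a b) = \<pi> b" if "invariant_measure U \<pi>" for \<pi> b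
    using that invariance_finite_sum[OF tm hess] by (simp add: invariant_measure_def)
  have pi_formula: "\<pi> a = \<pi> 0 * ?q a" if "invariant_measure U \<pi>" "a \<ge> 1" for \<pi> a
    using formula[OF balance] that by blast
  have pi_0: "\<pi> 0 > 0" if "invariant_measure U \<pi>" for \<pi>
  proof (rule ccontr)
    assume "\<not> \<pi> 0 > 0"
    with that have z: "\<pi> 0 = 0" by (metis invariant_measure_def less_eq_real_def)
    have "\<pi> a = 0" for a using pi_formula[OF that, of a] z by (cases a) auto
    with that show False by (simp add: invariant_measure_def)
  qed
  define \<rho> where "\<rho> = balance_solution U"
  have \<rho>_balance: "(\<Sum>a\<le>Suc b. \<rho> a * U a b) = \<rho> b" for b
    unfolding \<rho>_def using sub[of b] by (intro balance_solution_solves) simp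
  have \<rho>_0: "\<rho> 0 = 1" by (simp add: \<rho>_def)
  have \<rho>_pos: "\<rho> a > 0" for a
    by (rule invariance_solution_positive[OF tm irr hess \<rho>_balance]) (simp add: \<rho>_0)
  have \<rho>_inv: "invariant_measure U \<rho>"
    using \<rho>_balance \<rho>_pos invariance_finite_sum[OF tm hess]
    by (auto simp: invariant_measure_def less_imp_le intro!: exI[of _ 0] simp: \<rho>_0)
  have \<rho>_q: "\<rho> a = ?q a" if "a \<ge> 1" for a
    using pi_formula[OF \<rho>_inv that] by (simp add: \<rho>_0)
  have multiple: "\<pi> a = \<pi> 0 * \<rho> a" if "invariant_measure U \<pi>" for \<pi> a
    using pi_formula[OF that, of a] \<rho>_q[of a] \<rho>_0 by (cases "a = 0") auto
  have unique: "\<exists>c>0. \<forall>a. \<mu> a = c * \<pi> a"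
    if "invariant_measure U \<pi>" "invariant_measure U \<mu>" for \<pi> \<mu>
  proof (intro exI conjI allI)
    show "\<mu> 0 / \<pi> 0 > 0" using pi_0 that by simp
    show "\<mu> a = \<mu> 0 / \<pi> 0 * \<pi> a" for a
      unfolding multiple[OF that(1), of a] multiple[OF that(2), of a]
      using pi_0[OF that(1)] by simp
  qed
  have "summable (\<lambda>a. ?q (Suc a)) \<longleftrightarrow> summable (\<lambda>a. \<rho> (Suc a))"
    using \<rho>_q by simp
  also have "\<dots> \<longleftrightarrow> summable \<rho>" by (rule summable_Suc_iff)
  also have "summable \<rho> \<longleftrightarrow> positive_recurrent U"
  proof
    assume sum: "summable \<rho>"
    show "positive_recurrent U"
      unfolding positive_recurrent_def mean_return_time[OF tm]
    proof
      fix i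
      have "(\<Sum>y. excursion_occupation U i y) * ennreal (\<rho> i) =
          (\<Sum>y. excursion_occupation U i y * ennreal (\<rho> i))" by simp
      also have "\<dots> \<le> (\<Sum>y. ennreal (\<rho> y))"
        by (intro suminf_le excursion_occupation_le_invariant[OF tm \<rho>_inv] summableI)
      also have "\<dots> = ennreal (suminf \<rho>)"
        using sum \<rho>_pos by (intro suminf_ennreal_eq) (auto simp: less_imp_le)
      finally have "(\<Sum>y. excursion_occupation U i y) * ennreal (\<rho> i) < \<infinity>"
        by (simp add: le_less_trans)
      then show "(\<Sum>y. excursion_occupation U i y) < \<infinity>"
        using \<rho>_pos[of i] by (auto simp: ennreal_mult_less_top)
    qed
  next
    assume "positive_recurrent U"
    then have fin: "(\<Sum>y. excursion_occupation U 0 y) < \<infinity>"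
      by (simp add: positive_recurrent_def mean_return_time[OF tm])
    define \<mu> where "\<mu> y = enn2real (excursion_occupation U 0 y)" for y
    have \<mu>: "ennreal (\<mu> y) = excursion_occupation U 0 y" for y
      using ennreal_suminf_lessD[OF fin, of y] by (simp add: \<mu>_def)
    have \<mu>_nonneg: "0 \<le> \<mu> y" for y by (simp add: \<mu>_def)
    have U: "0 \<le> U a b" for a b using tm by (simp add: transition_matrix_def)
    have "(\<lambda>a. \<mu> a * U a b) sums \<mu> b" for b
    proof -
      have "(\<lambda>a. excursion_occupation U 0 a * ennreal (U a b)) sums excursion_occupation U 0 b"
        using summable_sums[OF summableI]
        by (metis excursion_occupation_invariant[OF tm fin])
      then have "(\<lambda>a. ennreal (\<mu> a * U a b)) sums ennreal (\<mu> b)"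
        using \<mu>_nonneg U by (simp only: ennreal_mult \<mu>)
      then show ?thesis using \<mu>_nonneg U by simp
    qed
    moreover have \<mu>_0: "\<mu> 0 = 1" by (simp add: \<mu>_def excursion_occupation_self[OF tm])
    ultimately have \<mu>_inv: "invariant_measure U \<mu>"
      using \<mu>_nonneg by (auto simp: invariant_measure_def intro!: exI[of _ 0])
    have "\<mu> = \<rho>" using multiple[OF \<mu>_inv] by (simp add: fun_eq_iff \<mu>_0)
    moreover have "summable \<mu>"
      using fin \<mu>_nonneg by (intro summable_suminf_not_top) (auto simp: \<mu>)
    ultimately show "summable \<rho>" by simp
  qed
  finally have recurrent: "summable (\<lambda>a. ?q (Suc a)) \<longleftrightarrow> positive_recurrent U" .
  show ?thesis
  proof (intro conjI allI impI)
    show "\<exists>\<pi>. invariant_measure U \<pi> \<and> (\<forall>a. \<pi> a > 0)"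
      using \<rho>_inv \<rho>_pos by blast
  qed (simp_all only: recurrent unique pi_0 pi_formula[symmetric])
qed

end
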